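(* Let $\mathbf{M}=(M;\leq,0,1)$ be a non-trivial complete lattice, let $S$ be a non-empty set, and let $\mathbf{A}$ be a bounded subposet of $\mathbf{M}^{S}$. Let $(\wp(S\times S);\subseteq)$ be the poset of all relations on $S$, and let $\mathrm{Map}_0(\mathbf{A},\mathbf{M}^S)$ be the set of all order-preserving mappings $P\colon A\to M^S$ with $P(0)=0$, ordered by $P_1\leq P_2$ if and only if $P_1(a)\leq P_2(a)$ for all $a\in A$. Define $\Phi(R)=P_R$ for $R\in\wp(S\times S)$ and $\Psi(P)=R^{P}$ for $P\in\mathrm{Map}_0(\mathbf{A},\mathbf{M}^S)$. Then $(\Phi,\Psi)$ is a Galois connection between $(\wp(S\times S);\subseteq)$ and $(\mathrm{Map}_0(\mathbf{A},\mathbf{M}^S);\leq)$, i.e., $\Phi$ and $\Psi$ are maps between these posets and for all $R$ and $P$: $\Phi(R)\leq P$ if and only if $R\subseteq \Psi(P)$.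
   Context: Non-trivial means $0\neq 1$. $\mathbf{M}^S$ is ordered componentwise; a bounded subposet of $\mathbf{M}^S$ is a subset containing the constant tuples $0$ and $1$ with the inherited order. For $s\in S$ and $m\in M^S$, $s(m)$ denotes the $s$-th component of $m$. For $R\subseteq S\times S$ (writing $sRt$ for $(s,t)\in R$), $P_R\colon A\to M^S$ is defined by $P_R(a)(t)=\bigvee_M\{s(a)\mid sRt\}$ (the empty join being $0$). For $P\colon A\to M^S$, $R^{P}=\{(s,t)\in S\times S\mid \forall a\in A:\ s(a)\leq t(P(a))\}$. *)

theory Defs
  imports "HOL-Algebra.Galois_Connection"
begin

text \<open>
  Tuples indexed by \<open>S\<close> are extensional functions (\<open>undefined\<close> outside \<open>S\<close>), so that \<open>s(m)\<close> is
  \<open>m s\<close> and the equality of the order structures below is plain equality. The bounds of a complete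
  lattice \<open>M\<close> are the library's \<open>\<bottom>\<^bsub>M\<^esub>\<close> and \<open>\<top>\<^bsub>M\<^esub>\<close>.
\<close>

definition power_order :: "('m, 'x) gorder_scheme \<Rightarrow> 's set \<Rightarrow> ('s \<Rightarrow> 'm) gorder"
  where "power_order M S =
    \<lparr> carrier = S \<rightarrow>\<^sub>E carrier M, eq = (=), le = (\<lambda>m n. \<forall>s\<in>S. m s \<sqsubseteq>\<^bsub>M\<^esub> n s) \<rparr>"

definition bounded_subposet :: "('m, 'x) gorder_scheme \<Rightarrow> 's set \<Rightarrow> ('s \<Rightarrow> 'm) set \<Rightarrow> bool"
  where "bounded_subposet M S A \<longleftrightarrow>
    A \<subseteq> carrier (power_order M S) \<and> (\<lambda>s\<in>S. \<bottom>\<^bsub>M\<^esub>) \<in> A \<and> (\<lambda>s\<in>S. \<top>\<^bsub>M\<^esub>) \<in> A"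

definition Map0 ::
  "('m, 'x) gorder_scheme \<Rightarrow> 's set \<Rightarrow> ('s \<Rightarrow> 'm) set \<Rightarrow> (('s \<Rightarrow> 'm) \<Rightarrow> ('s \<Rightarrow> 'm)) gorder"
  where "Map0 M S A =
    \<lparr> carrier = {P \<in> A \<rightarrow>\<^sub>E carrier (power_order M S).
        isotone ((power_order M S)\<lparr>carrier := A\<rparr>) (power_order M S) P \<and>
        P (\<lambda>s\<in>S. \<bottom>\<^bsub>M\<^esub>) = (\<lambda>s\<in>S. \<bottom>\<^bsub>M\<^esub>)},
      eq = (=),
      le = (\<lambda>P\<^sub>1 P\<^sub>2. \<forall>a\<in>A. P\<^sub>1 a \<sqsubseteq>\<^bsub>power_order M S\<^esub> P\<^sub>2 a) \<rparr>"

definition rel_order :: "'s set \<Rightarrow> ('s \<times> 's) set gorder"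
  where "rel_order S = \<lparr> carrier = Pow (S \<times> S), eq = (=), le = (\<subseteq>) \<rparr>"

text \<open>
  The join \<open>\<Squnion>\<^bsub>M\<^esub>\<close> of the empty set is a least element of \<open>carrier M\<close>, i.e. \<open>\<bottom>\<^bsub>M\<^esub>\<close>, as required.
\<close>

definition map_of_rel ::
  "('m, 'x) gorder_scheme \<Rightarrow> 's set \<Rightarrow> ('s \<Rightarrow> 'm) set \<Rightarrow> ('s \<times> 's) set \<Rightarrow> ('s \<Rightarrow> 'm) \<Rightarrow> ('s \<Rightarrow> 'm)"
  where "map_of_rel M S A R = (\<lambda>a\<in>A. \<lambda>t\<in>S. \<Squnion>\<^bsub>M\<^esub> {a s |s. (s, t) \<in> R})"

definition rel_of_map ::
  "('m, 'x) gorder_scheme \<Rightarrow> 's set \<Rightarrow> ('s \<Rightarrow> 'm) set \<Rightarrow> (('s \<Rightarrow> 'm) \<Rightarrow> ('s \<Rightarrow> 'm)) \<Rightarrow> ('s \<times> 's) set"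
  where "rel_of_map M S A P = {(s, t) \<in> S \<times> S. \<forall>a\<in>A. a s \<sqsubseteq>\<^bsub>M\<^esub> P a t}"

end

theory Submission
  imports Defs
begin

text \<open>
  Both \<open>\<Phi>(R) \<le> P\<close> and \<open>R \<subseteq> \<Psi>(P)\<close> say that \<open>s(a) \<le> t(P(a))\<close> for all \<open>a \<in> A\<close> and \<open>s R t\<close>:
  the former by the universal property of the join \<open>\<Phi>(R)(a)(t)\<close>, the latter by definition.
\<close>

lemma carrier_power_order [simp]: "carrier (power_order M S) = S \<rightarrow>\<^sub>E carrier M"
  by (simp add: power_order_def)

lemma le_power_order [simp]: "m \<sqsubseteq>\<^bsub>power_order M S\<^esub> n \<longleftrightarrow> (\<forall>s\<in>S. m s \<sqsubseteq>\<^bsub>M\<^esub> n s)"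
  by (simp add: power_order_def)

text \<open>The order laws of \<open>M\<close> transfer componentwise. Antisymmetry yields equality
  of tuples because they are extensional: agreement on \<open>S\<close> determines them.\<close>

lemma partial_order_power_order:
  assumes "partial_order M"
  shows "partial_order (power_order M S)"
proof -
  interpret partial_order M by fact
  have eq: "eq (power_order M S) = (=)"
    by (simp add: power_order_def)
  show ?thesis
  proof (unfold_locales, simp_all only: eq carrier_power_order le_power_order)
    fix m
    assume "m \<in> S \<rightarrow>\<^sub>E carrier M"
    then show "\<forall>s\<in>S. m s \<sqsubseteq>\<^bsub>M\<^esub> m s"
      by (blast intro: le_refl PiE_mem)
  next
    fix m n
    assume "\<forall>s\<in>S. m s \<sqsubseteq>\<^bsub>M\<^esub> n s" "\<forall>s\<in>S. n s \<sqsubseteq>\<^bsub>M\<^esub> m s"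
      "m \<in> S \<rightarrow>\<^sub>E carrier M" "n \<in> S \<rightarrow>\<^sub>E carrier M"
    then show "m = n"
      by (intro PiE_ext[of m S _ n]) (auto intro!: le_antisym)
  next
    fix m n p
    assume "\<forall>s\<in>S. m s \<sqsubseteq>\<^bsub>M\<^esub> n s" "\<forall>s\<in>S. n s \<sqsubseteq>\<^bsub>M\<^esub> p s"
      "m \<in> S \<rightarrow>\<^sub>E carrier M" "n \<in> S \<rightarrow>\<^sub>E carrier M" "p \<in> S \<rightarrow>\<^sub>E carrier M"
    then show "\<forall>s\<in>S. m s \<sqsubseteq>\<^bsub>M\<^esub> p s"
      by (fast intro: le_trans dest: PiE_mem)
  qed
qed

lemma partial_order_rel_order: "partial_order (rel_order S)"
  by unfold_locales (auto simp: rel_order_def)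

lemma partial_order_Map0:
  assumes "partial_order M"
  shows "partial_order (Map0 M S A)"
proof -
  interpret partial_order "power_order M S"
    using assms by (rule partial_order_power_order)
  have maps: "P a \<in> carrier (power_order M S)" if "P \<in> carrier (Map0 M S A)" "a \<in> A" for P a
    using that unfolding Map0_def by (auto simp del: carrier_power_order)
  have eq: "eq (Map0 M S A) = (=)"
    and le: "P \<sqsubseteq>\<^bsub>Map0 M S A\<^esub> Q \<longleftrightarrow> (\<forall>a\<in>A. P a \<sqsubseteq>\<^bsub>power_order M S\<^esub> Q a)" for P Q
    by (simp_all add: Map0_def)
  show ?thesis
  \<comment> \<open>The order is unfolded only down to that of \<open>power_order M S\<close>, so
    that the laws of the interpreted tuple order apply at each argument \<open>a\<close>.\<close>
  proof (unfold_locales, simp_all only: eq le)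
    fix P
    assume "P \<in> carrier (Map0 M S A)"
    then show "\<forall>a\<in>A. P a \<sqsubseteq>\<^bsub>power_order M S\<^esub> P a"
      by (blast intro: le_refl maps)
  next
    fix P Q
    assume PQ: "P \<in> carrier (Map0 M S A)" "Q \<in> carrier (Map0 M S A)"
      and "\<forall>a\<in>A. P a \<sqsubseteq>\<^bsub>power_order M S\<^esub> Q a" "\<forall>a\<in>A. Q a \<sqsubseteq>\<^bsub>power_order M S\<^esub> P a"
    then have "P a = Q a" if "a \<in> A" for a
      using that by (intro le_antisym maps) blast+
    \<comment> \<open>Both maps are \<open>undefined\<close> outside \<open>A\<close>, so agreement
      on \<open>A\<close> suffices.\<close>
    with PQ show "P = Q"
      unfolding Map0_def by (auto intro: PiE_ext)
  next
    fix P Q T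
    assume "P \<in> carrier (Map0 M S A)" "Q \<in> carrier (Map0 M S A)" "T \<in> carrier (Map0 M S A)"
      and "\<forall>a\<in>A. P a \<sqsubseteq>\<^bsub>power_order M S\<^esub> Q a" "\<forall>a\<in>A. Q a \<sqsubseteq>\<^bsub>power_order M S\<^esub> T a"
    then show "\<forall>a\<in>A. P a \<sqsubseteq>\<^bsub>power_order M S\<^esub> T a"
      by (meson le_trans maps)
  qed
qed

context complete_lattice
begin

text \<open>One direction is transitivity through the upper bound \<open>\<Squnion>B\<close>, the
  other is leastness. This is the step from joins to single inequalities in the adjunction.\<close>

lemma sup_le_iff:
  assumes "B \<subseteq> carrier L" "z \<in> carrier L"
  shows "\<Squnion>B \<sqsubseteq> z \<longleftrightarrow> (\<forall>x\<in>B. x \<sqsubseteq> z)"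
  using assms by (meson le_trans sup_closed sup_least sup_upper subsetD)

text \<open>Inclusion instead of equality covers the empty join as well. Both cases occur when the
  zero tuple is mapped, since an index \<open>t\<close> may have no
  \<open>R\<close>-predecessor.\<close>

lemma sup_subset_bottom:
  assumes "B \<subseteq> {\<bottom>}"
  shows "\<Squnion>B = \<bottom>"
proof -
  have "B \<subseteq> carrier L"
    using assms by auto
  then show ?thesis
    using assms by (intro le_antisym) (auto simp: sup_le_iff)
qed

text \<open>This is the well-definedness of \<Phi>. Monotonicity holds since every
  \<open>a s\<close> in the first join lies below \<open>b s\<close>, which lies below the second
  join.\<close>

lemma map_of_rel_in_Map0:
  assumes A: "bounded_subposet L S A" and R: "R \<subseteq> S \<times> S"
  shows "map_of_rel L S A R \<in> carrier (Map0 L S A)"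
proof -
  interpret pow: partial_order "power_order L S"
    by (intro partial_order_power_order partial_order_axioms)
  have AS: "A \<subseteq> carrier (power_order L S)" and bot: "(\<lambda>s\<in>S. \<bottom>) \<in> A"
    using A by (auto simp: bounded_subposet_def)
  \<comment> \<open>Since \<open>R\<close> relates only indices from \<open>S\<close>, no
    \<open>undefined\<close> component enters a join.\<close>
  have comp: "{a s |s. (s, t) \<in> R} \<subseteq> carrier L" if "a \<in> A" for a t
    using that AS R by auto
  have maps: "map_of_rel L S A R \<in> A \<rightarrow>\<^sub>E carrier (power_order L S)"
    using comp by (auto simp: map_of_rel_def)
  have "isotone ((power_order L S)\<lparr>carrier := A\<rparr>) (power_order L S) (map_of_rel L S A R)"
  proof (rule isotoneI)
    \<comment> \<open>\<open>isotone\<close> includes that source and target are weak partial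
      orders; \<open>A\<close> inherits this from the power.\<close>
    show "weak_partial_order ((power_order L S)\<lparr>carrier := A\<rparr>)"
      using pow.weak_partial_order_axioms AS by (rule weak_partial_order_subset)
    show "weak_partial_order (power_order L S)" ..
    fix a b
    assume ab: "a \<in> carrier ((power_order L S)\<lparr>carrier := A\<rparr>)"
      "b \<in> carrier ((power_order L S)\<lparr>carrier := A\<rparr>)"
      and le: "a \<sqsubseteq>\<^bsub>(power_order L S)\<lparr>carrier := A\<rparr>\<^esub> b"
    have "\<Squnion>{a s |s. (s, t) \<in> R} \<sqsubseteq> \<Squnion>{b s |s. (s, t) \<in> R}" for t
    proof (rule sup_least)
      fix x
      assume "x \<in> {a s |s. (s, t) \<in> R}"
      then obtain s where s: "(s, t) \<in> R" "x = a s" by blast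
      then have "a s \<sqsubseteq> b s"
        using R le by auto
      moreover have "b s \<sqsubseteq> \<Squnion>{b s |s. (s, t) \<in> R}"
        using s ab comp by (intro sup_upper) auto
      moreover have "a s \<in> carrier L" "b s \<in> carrier L"
        using s ab AS R by auto
      ultimately show "x \<sqsubseteq> \<Squnion>{b s |s. (s, t) \<in> R}"
        using s ab comp by (auto intro: le_trans)
    qed (use ab comp in auto)
    then show "map_of_rel L S A R a \<sqsubseteq>\<^bsub>power_order L S\<^esub> map_of_rel L S A R b"
      using ab by (simp add: map_of_rel_def)
  qed
  moreover have "\<Squnion>{(\<lambda>s\<in>S. \<bottom>) s |s. (s, t) \<in> R} = \<bottom>" for t
    using R by (intro sup_subset_bottom) auto
  then have "map_of_rel L S A R (\<lambda>s\<in>S. \<bottom>) = (\<lambda>s\<in>S. \<bottom>)"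
    using bot by (simp add: map_of_rel_def)
  ultimately show ?thesis
    using maps by (simp add: Map0_def)
qed

text \<open>For fixed \<open>a\<close> and \<open>t\<close>, \<open>sup_le_iff\<close> replaces the
  join by one inequality for each \<open>s\<close> with \<open>(s, t)\<close> in \<open>R\<close>.
  Exchanging the quantifiers over \<open>a\<close> and over the pairs then gives the
  inclusion.\<close>

lemma map_of_rel_le_iff:
  assumes A: "A \<subseteq> carrier (power_order L S)" and R: "R \<subseteq> S \<times> S"
    and P: "P \<in> A \<rightarrow>\<^sub>E carrier (power_order L S)"
  shows "(\<forall>a\<in>A. map_of_rel L S A R a \<sqsubseteq>\<^bsub>power_order L S\<^esub> P a) \<longleftrightarrow> R \<subseteq> rel_of_map L S A P"
proof -
  have "\<Squnion>{a s |s. (s, t) \<in> R} \<sqsubseteq> P a t \<longleftrightarrow> (\<forall>s. (s, t) \<in> R \<longrightarrow> a s \<sqsubseteq> P a t)"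
    if "a \<in> A" "t \<in> S" for a t
  proof (subst sup_le_iff)
    show "{a s |s. (s, t) \<in> R} \<subseteq> carrier L"
      using that A R by auto
    show "P a t \<in> carrier L"
      using P that by auto
  qed auto
  \<comment> \<open>As \<open>R\<close> lies within \<open>S \<times> S\<close>, letting
    \<open>t\<close> range over \<open>S\<close> reaches every pair of \<open>R\<close>, and the
    membership condition in \<open>rel_of_map\<close> is met.\<close>
  then show ?thesis
    using R by (auto simp: map_of_rel_def rel_of_map_def)
qed

end

theorem theorem2p4:
  fixes M :: "('m, 'x) gorder_scheme" and S :: "'s set" and A :: "('s \<Rightarrow> 'm) set"
  assumes "complete_lattice M"
    and "\<bottom>\<^bsub>M\<^esub> \<noteq> \<top>\<^bsub>M\<^esub>"
    and "S \<noteq> {}"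
    and "bounded_subposet M S A"
  shows "galois_connection
    \<lparr> orderA = rel_order S, orderB = Map0 M S A,
      lower = map_of_rel M S A, upper = rel_of_map M S A \<rparr>"
proof -
  interpret complete_lattice M by fact
  have A: "A \<subseteq> carrier (power_order M S)"
    using assms(4) by (simp add: bounded_subposet_def)
  show ?thesis
  \<comment> \<open>The locale splits into five obligations: two partial orders, the typing of
    \<Phi> and \<Psi>, and the adjunction.\<close>
  proof (intro galois_connection.intro connection.intro galois_connection_axioms.intro, simp_all only: galcon.simps)
    show "partial_order (rel_order S)"
      by (rule partial_order_rel_order)
    show "partial_order (Map0 M S A)"
      by (intro partial_order_Map0 partial_order_axioms)
    show "map_of_rel M S A \<in> carrier (rel_order S) \<rightarrow> carrier (Map0 M S A)"
      using map_of_rel_in_Map0[OF assms(4)] by (auto simp: rel_order_def)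
    show "rel_of_map M S A \<in> carrier (Map0 M S A) \<rightarrow> carrier (rel_order S)"
      by (auto simp: rel_order_def rel_of_map_def)
    fix R P
    assume "R \<in> carrier (rel_order S)" "P \<in> carrier (Map0 M S A)"
    then show "map_of_rel M S A R \<sqsubseteq>\<^bsub>Map0 M S A\<^esub> P \<longleftrightarrow> R \<sqsubseteq>\<^bsub>rel_order S\<^esub> rel_of_map M S A P"
      using map_of_rel_le_iff[OF A, of R P] by (simp add: Map0_def rel_order_def)
  qed
qed

end
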